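(* For every $\omega\in\Omega$, the trajectory $t\mapsto X_t$ is continuous at Lebesgue-almost every point of $[0,\infty)$, and therefore is Riemann integrable on any bounded interval $[u,v]\subset[0,\infty)$.
   Context: Fix $H\in(0,\tfrac12)$ and constants $X_0>0$, $a>0$, $b\ge 0$, $\sigma>0$. $B^H=\{B^H_t,\ t\ge 0\}$ is a fractional Brownian motion with Hurst parameter $H$ on a complete probability space $(\Omega,\mathcal{F},\mathbb{P})$, i.e. a mean zero Gaussian process with covariance $\mathbb{E}(B^H_tB^H_s)=\frac12(t^{2H}+s^{2H}-|t-s|^{2H})$. A version is fixed such that, for every $\omega\in\Omega$, $B^H_0(\omega)=0$ and the trajectory $t\mapsto B^H_t(\omega)$ is continuous and, on each interval $[0,T]$ and for each $\gamma\in(0,H)$, Hölder continuous of order $H-\gamma$; all pathwise statements are for an arbitrary fixed $\omega\in\Omega$. For $\varepsilon>0$, $X^\varepsilon=\{X^\varepsilon_t\}$ denotes the unique continuous process satisfying, for all $t\ge0$, $$X^\varepsilon_t=X_0+a\int_0^t\frac{(s+\varepsilon)^{2H-1}}{X^\varepsilon_s\mathbf{1}_{\{X^\varepsilon_s>0\}}+\varepsilon}\,ds-b\int_0^tX^\varepsilon_s\,ds+\sigma B^H_t.$$ For each $t\ge 0$, $X^\varepsilon_t$ is monotone in $\varepsilon$ (nondecreasing as $\varepsilon$ decreases) and bounded above uniformly in $\varepsilon$, and the process $X=\{X_t,\ t\ge0\}$ is defined by the finite pointwise limit $X_t=\lim_{\varepsilon\downarrow 0}X^\varepsilon_t$. 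*)

theory Defs
  imports "HOL-Probability.Probability"
begin

text \<open>A constant counts as a (degenerate) Gaussian variable; this is needed for \<open>B 0 = 0\<close>
  and for linear combinations with vanishing variance.\<close>

definition gaussian_rv :: "'w measure \<Rightarrow> ('w \<Rightarrow> real) \<Rightarrow> bool" where
  "gaussian_rv M Y \<longleftrightarrow> Y \<in> borel_measurable M \<and>
     ((\<exists>\<mu>. AE \<omega> in M. Y \<omega> = \<mu>) \<or>
      (\<exists>\<mu> s. s > 0 \<and> distributed M lborel Y (normal_density \<mu> s)))"

definition gaussian_process :: "'w measure \<Rightarrow> (real \<Rightarrow> 'w \<Rightarrow> real) \<Rightarrow> bool" where
  "gaussian_process M B \<longleftrightarrow>
     (\<forall>J c. finite J \<and> J \<subseteq> {0..} \<longrightarrow> gaussian_rv M (\<lambda>\<omega>. \<Sum>t\<in>J. c t * B t \<omega>))"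

text \<open>Processes have type \<^typ>\<open>real \<Rightarrow> 'w \<Rightarrow> real\<close>; only times \<open>t \<ge> 0\<close> are meaningful, and
  values at negative times are unconstrained.\<close>

definition fractional_brownian_motion ::
  "'w measure \<Rightarrow> real \<Rightarrow> (real \<Rightarrow> 'w \<Rightarrow> real) \<Rightarrow> bool" where
  "fractional_brownian_motion M H B \<longleftrightarrow>
     gaussian_process M B \<and>
     (\<forall>t\<ge>0. prob_space.expectation M (B t) = 0) \<and>
     (\<forall>t\<ge>0. \<forall>s\<ge>0. prob_space.expectation M (\<lambda>\<omega>. B t \<omega> * B s \<omega>)
        = 1/2 * (t powr (2 * H) + s powr (2 * H) - \<bar>t - s\<bar> powr (2 * H)))"

definition hoelder_on :: "real set \<Rightarrow> real \<Rightarrow> (real \<Rightarrow> real) \<Rightarrow> bool" where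
  "hoelder_on S \<alpha> f \<longleftrightarrow> (\<exists>C. \<forall>s\<in>S. \<forall>t\<in>S. \<bar>f t - f s\<bar> \<le> C * \<bar>t - s\<bar> powr \<alpha>)"

definition regular_paths :: "'w measure \<Rightarrow> real \<Rightarrow> (real \<Rightarrow> 'w \<Rightarrow> real) \<Rightarrow> bool" where
  "regular_paths M H B \<longleftrightarrow> (\<forall>\<omega>\<in>space M.
     B 0 \<omega> = 0 \<and>
     continuous_on {0..} (\<lambda>t. B t \<omega>) \<and>
     (\<forall>T>0. \<forall>\<gamma>\<in>{0<..<H}. hoelder_on {0..T} (H - \<gamma>) (\<lambda>t. B t \<omega>)))"

text \<open>For a continuous path \<open>Y\<close> and \<open>\<epsilon> > 0\<close> both integrands below are continuous, so the
  integrals are ordinary ones.\<close>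

definition regularised_solution ::
  "'w measure \<Rightarrow> real \<Rightarrow> real \<Rightarrow> real \<Rightarrow> real \<Rightarrow> real \<Rightarrow> (real \<Rightarrow> 'w \<Rightarrow> real) \<Rightarrow> real
     \<Rightarrow> (real \<Rightarrow> 'w \<Rightarrow> real) \<Rightarrow> bool" where
  "regularised_solution M H x0 a b \<sigma> B \<epsilon> Y \<longleftrightarrow>
     (\<forall>t\<ge>0. Y t \<in> borel_measurable M) \<and>
     (\<forall>\<omega>\<in>space M. continuous_on {0..} (\<lambda>t. Y t \<omega>) \<and>
       (\<forall>t\<ge>0. Y t \<omega> = x0
          + a * integral {0..t}
              (\<lambda>s. (s + \<epsilon>) powr (2 * H - 1) / (Y s \<omega> * indicator {0<..} (Y s \<omega>) + \<epsilon>))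
          - b * integral {0..t} (\<lambda>s. Y s \<omega>)
          + \<sigma> * B t \<omega>))"

text \<open>The library integral on \<^typ>\<open>real\<close> is the Henstock--Kurzweil integral, whose gauge may
  depend on the tag. Riemann's integral uses a uniform bound on the mesh of the tagged partition.\<close>

definition riemann_integrable :: "(real \<Rightarrow> real) \<Rightarrow> real \<Rightarrow> real \<Rightarrow> bool" where
  "riemann_integrable f u v \<longleftrightarrow> (\<exists>I. \<forall>e>0. \<exists>\<delta>>0. \<forall>p.
     p tagged_division_of {u..v} \<and> (\<forall>(x, K)\<in>p. measure lborel K < \<delta>)
       \<longrightarrow> \<bar>(\<Sum>(x, K)\<in>p. measure lborel K * f x) - I\<bar> < e)"

end

theory Submission
  imports Defs
begin

text \<open>Everything is pathwise. A comparison argument shows that \<open>Y \<epsilon>\<close> increases as \<open>\<epsilon>\<close> decreases,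
  and the paths are bounded on compacts uniformly in \<open>\<epsilon>\<close>. Hence the integrated drift is bounded,
  while on \<open>{Y \<epsilon> \<le> 0}\<close> the drift is of order \<open>1 / \<epsilon>\<close>; so that set has measure \<open>O(\<epsilon>)\<close>, and
  \<open>{X \<le> 0}\<close>, which it contains, is negligible. At times \<open>t > 0\<close> with \<open>X t > 0\<close> the limit is
  continuous. Riemann integrability is then Lebesgue's criterion.\<close>

section \<open>Riemann integrability of bounded, almost everywhere continuous functions\<close>

text \<open>A tagged division with mesh tending to 0 gives step functions that converge to \<open>f\<close> at every
  continuity point off the division boundaries; dominated convergence then forces the Riemann sums
  to converge to the integral.\<close>

lemma bounded_ae_continuous_imp_riemann_integrable:
  fixes f :: "real \<Rightarrow> real"
  assumes N: "negligible N"
    and cont: "\<And>x. x \<in> {u..v} - N \<Longrightarrow> continuous (at x within {u..v}) f"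
    and bdd: "\<And>x. x \<in> {u..v} \<Longrightarrow> \<bar>f x\<bar> \<le> C"
  shows "riemann_integrable f u v"
proof (rule ccontr)
  define close where "close \<delta> p \<longleftrightarrow> p tagged_division_of {u..v} \<and> (\<forall>(x, K)\<in>p. measure lborel K < \<delta>)"
    for \<delta> p
  define S where "S p = (\<Sum>(x, K)\<in>p. measure lborel K * f x)" for p :: "(real \<times> real set) set"
  let ?I = "integral {u..v} f"
  assume "\<not> riemann_integrable f u v"
  then obtain e where "e > 0" and e: "\<And>\<delta>. \<delta> > 0 \<Longrightarrow> \<exists>p. close \<delta> p \<and> \<bar>S p - ?I\<bar> \<ge> e"
    unfolding riemann_integrable_def close_def S_def by (meson not_less)
  \<comment> \<open>Failure of the criterion for the candidate value \<open>?I\<close> gives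
    divisions with mesh tending to 0 whose Riemann sums all stay at distance at least
    \<open>e\<close> from \<open>?I\<close>. Integrability of \<open>f\<close> is not assumed here;
    dominated convergence below identifies \<open>?I\<close> as the limit of these sums.\<close>
  have "\<exists>p. close (inverse (Suc n)) p \<and> \<bar>S p - ?I\<bar> \<ge> e" for n
    using e[of "inverse (Suc n)"] by simp
  then obtain p where p: "\<And>n. close (inverse (Suc n)) (p n)" and far: "\<And>n. \<bar>S (p n) - ?I\<bar> \<ge> e"
    by metis
  have tag: "p n tagged_division_of {u..v}" for n
    using p by (simp add: close_def)
  have fin: "finite (p n)" for n
    using tag by blast
  have box: "\<exists>c d. K = cbox c d" if "(x, K) \<in> p n" for n x K
    by (rule tagged_division_ofD(4)[OF tag that])
  \<comment> \<open>Cells may overlap on their boundaries, so these are discarded for all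
    \<open>n\<close> at once. Only countably many null sets are added to \<open>N\<close>.\<close>
  define N' where "N' = N \<union> (\<Union>n. \<Union>(x, K)\<in>p n. frontier K)"
  have "negligible (\<Union>(x, K)\<in>p n. frontier K)" for n
  proof (intro negligible_Union finite_imageI fin)
    fix t assume "t \<in> (\<lambda>(x, K). frontier K) ` p n"
    then obtain x K where xK: "(x, K) \<in> p n" "t = frontier K"
      by auto
    obtain c d where "K = cbox c d"
      using box[OF xK(1)] by blast
    then show "negligible t"
      unfolding xK(2) by (simp only: frontier_cbox negligible_frontier_interval)
  qed
  then have N': "negligible N'"
    unfolding N'_def using N by (intro negligible_Un negligible_countable_Union) auto
  \<comment> \<open>The step function carrying the tag value on each cell; its integral is exactly
    the Riemann sum of \<open>p n\<close>.\<close>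
  define g where "g n y = (\<Sum>(x, K)\<in>p n. f x * indicator K y)" for n y
  have g_integral: "(g n has_integral S (p n)) {u..v}" for n
    unfolding g_def S_def
  proof (rule has_integral_sum[OF fin])
    fix q assume "q \<in> p n"
    then obtain x K where q: "q = (x, K)" and xK: "(x, K) \<in> p n"
      by (cases q) auto
    obtain c d where K: "K = cbox c d"
      using box[OF xK] by blast
    have "((\<lambda>_. f x) has_integral measure lborel K *\<^sub>R f x) K"
      unfolding K by (rule has_integral_const)
    then have "((\<lambda>y. if y \<in> K then f x else 0) has_integral measure lborel K *\<^sub>R f x) {u..v}"
      by (subst has_integral_restrict[OF tagged_division_ofD(3)[OF tag xK]])
    moreover have "(\<lambda>y. case q of (x, K) \<Rightarrow> f x * indicator K y) = (\<lambda>y. if y \<in> K then f x else 0)"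
      by (auto simp: q indicator_def)
    ultimately show "((\<lambda>y. case q of (x, K) \<Rightarrow> f x * indicator K y)
        has_integral (case q of (x, K) \<Rightarrow> measure lborel K * f x)) {u..v}"
      by (simp add: q)
  qed
  \<comment> \<open>Off \<open>N'\<close>, every cell containing \<open>y\<close> contains it in its
    interior. Interiors of distinct cells are disjoint, so only one summand survives. Its tag shares
    with \<open>y\<close> a cell shorter than the mesh bound.\<close>
  have g_eq: "\<exists>x\<in>{u..v}. \<bar>x - y\<bar> < inverse (Suc n) \<and> g n y = f x" if y: "y \<in> {u..v} - N'" for n y
  proof -
    obtain x K where xK: "(x, K) \<in> p n" "y \<in> K"
      using y tagged_division_ofD(6)[OF tag[of n]] unfolding set_eq_iff by fastforce
    have int: "y \<in> interior L" if "(z, L) \<in> p n" "y \<in> L" for z L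
    proof -
      have "y \<notin> frontier L"
        using y that unfolding N'_def by blast
      then show ?thesis
        using that closure_subset unfolding frontier_def by blast
    qed
    have other: "f z * indicator L y = 0" if "(z, L) \<in> p n - {(x, K)}" for z L
    proof -
      have "interior L \<inter> interior K = {}"
        using tagged_division_ofD(5)[OF tag _ xK(1), of z L] that by auto
      then show ?thesis
        using int[OF xK] int[of z L] that by (auto simp: indicator_def)
    qed
    have "g n y = f x * indicator K y + (\<Sum>(z, L)\<in>p n - {(x, K)}. f z * indicator L y)"
      unfolding g_def by (subst sum.remove[OF fin xK(1)]) simp
    also have "(\<Sum>(z, L)\<in>p n - {(x, K)}. f z * indicator L y) = 0"
      unfolding case_prod_unfold by (intro sum.neutral ballI other) simp
    finally have "g n y = f x"
      using xK by simp
    moreover have "x \<in> K" "K \<subseteq> {u..v}"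
      using tagged_division_ofD(2,3)[OF tag xK(1)] by auto
    moreover have "\<bar>x - y\<bar> < inverse (Suc n)"
    proof -
      obtain c d where K: "K = {c..d}"
        using box[OF xK(1)] by auto
      moreover have "measure lborel K < inverse (Suc n)"
        using p[of n] xK(1) unfolding close_def by auto
      ultimately show ?thesis
        using \<open>x \<in> K\<close> xK(2) by auto
    qed
    ultimately show ?thesis
      by auto
  qed
  have "(\<lambda>n. integral ({u..v} - N') (g n)) \<longlonglongrightarrow> integral ({u..v} - N') f"
  proof (rule dominated_convergence(2))
    have neg: "negligible {x \<in> ({u..v} - N') - {u..v}. h x \<noteq> 0}"
      "negligible {x \<in> {u..v} - ({u..v} - N'). h x \<noteq> 0}" for h :: "real \<Rightarrow> real"
      using N' by (auto intro: negligible_subset)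
    show "g n integrable_on {u..v} - N'" for n
      using integrable_spike_set[OF _ neg(2) neg(1)] g_integral by blast
    show "(\<lambda>_. C) integrable_on {u..v} - N'"
      using integrable_spike_set[OF _ neg(2) neg(1)] integrable_const_ivl by blast
    show "norm (g n y) \<le> C" if "y \<in> {u..v} - N'" for n y
      using g_eq[OF that, of n] bdd by auto
    show "(\<lambda>n. g n y) \<longlonglongrightarrow> f y" if y: "y \<in> {u..v} - N'" for y
    proof -
      obtain x where x: "\<And>n. x n \<in> {u..v}" "\<And>n. \<bar>x n - y\<bar> < inverse (Suc n)" "\<And>n. g n y = f (x n)"
        using g_eq[OF y] by metis
      have "(\<lambda>n. x n - y) \<longlonglongrightarrow> 0"
        by (rule Lim_null_comparison[OF _ LIMSEQ_inverse_real_of_nat]) (use x(2) in \<open>auto intro: always_eventually less_imp_le\<close>)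
      then have "x \<longlonglongrightarrow> y"
        by (simp add: LIM_zero_iff)
      moreover have "continuous (at y within {u..v}) f"
        using cont y unfolding N'_def by blast
      ultimately show ?thesis
        unfolding x(3) using x(1) by (auto simp: continuous_within_sequentially o_def)
    qed
  qed
  moreover have "integral ({u..v} - N') h = integral {u..v} h" for h :: "real \<Rightarrow> real"
    by (rule integral_spike_set) (use N' in \<open>auto intro: negligible_subset\<close>)
  ultimately have "(\<lambda>n. S (p n)) \<longlonglongrightarrow> ?I"
    using integral_unique[OF g_integral] by simp
  then have "eventually (\<lambda>n. \<bar>S (p n) - ?I\<bar> < e) sequentially"
    using \<open>e > 0\<close> by (simp add: tendsto_iff dist_real_def)
  then obtain n where "\<bar>S (p n) - ?I\<bar> < e"
    using eventually_happens'[OF sequentially_bot] by blast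
  then show False
    using far[of n] by linarith
qed

text \<open>The set where \<open>c \<le> f\<close> is compact, so it has a last point
  \<open>s\<close>; a value above \<open>c\<close> there would force a later crossing by the
  intermediate value theorem. Restarting the integral equation at \<open>s\<close> gives a sign
  condition on the whole remaining interval.\<close>

lemma last_crossing:
  fixes f :: "real \<Rightarrow> real"
  assumes cont: "continuous_on {u..v} f" and "u \<le> v" "c \<le> f u" "f v < c"
  obtains s where "u \<le> s" "s < v" "f s = c" "\<And>r. s < r \<Longrightarrow> r \<le> v \<Longrightarrow> f r < c"
proof -
  let ?A = "{r \<in> {u..v}. c \<le> f r}"
  have "closed ?A"
    using continuous_closed_preimage[OF cont, of "{c..}"] by (simp add: vimage_def Int_def)
  moreover have "bounded ?A"
    by (rule bounded_subset[OF bounded_closed_interval[of u v]]) auto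
  ultimately have "compact ?A"
    by (simp add: compact_eq_bounded_closed)
  moreover have "u \<in> ?A"
    using assms by simp
  ultimately obtain s where s: "s \<in> ?A" "\<And>r. r \<in> ?A \<Longrightarrow> r \<le> s"
    using compact_attains_sup[of ?A] by blast
  have below: "f r < c" if "s < r" "r \<le> v" for r
    using s(1) s(2)[of r] that by force
  have "s < v"
    using s(1) \<open>f v < c\<close> by (cases "s = v") auto
  moreover have "f s = c"
  proof (rule ccontr)
    assume "f s \<noteq> c"
    then have "c < f s"
      using s(1) by simp
    obtain r where "s \<le> r" "r \<le> v" "f r = c"
      using IVT2'[of f v c s] \<open>c < f s\<close> \<open>f v < c\<close> \<open>s < v\<close> s(1) continuous_on_subset[OF cont, of "{s..v}"]
      by auto
    then show False
      using below[of r] \<open>c < f s\<close> by (cases "r = s") auto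
  qed
  ultimately show ?thesis
    using that below s(1) by auto
qed

section \<open>The regularised equation along one trajectory\<close>

locale regularised_paths =
  fixes H x0 a b :: real and \<beta> :: "real \<Rightarrow> real" and Y :: "real \<Rightarrow> real \<Rightarrow> real"
  assumes H: "0 < H" "H < 1/2" and x0: "0 < x0" and a: "0 < a" and b: "0 \<le> b"
    and \<beta>_cont: "continuous_on {0..} \<beta>" and \<beta>_0: "\<beta> 0 = 0"
    and Y_cont: "\<And>\<epsilon>. 0 < \<epsilon> \<Longrightarrow> continuous_on {0..} (Y \<epsilon>)"
    and Y_eq: "\<And>\<epsilon> t. 0 < \<epsilon> \<Longrightarrow> 0 \<le> t \<Longrightarrow> Y \<epsilon> t = x0
      + a * integral {0..t} (\<lambda>s. (s + \<epsilon>) powr (2 * H - 1) / (Y \<epsilon> s * indicator {0<..} (Y \<epsilon> s) + \<epsilon>))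
      - b * integral {0..t} (\<lambda>s. Y \<epsilon> s) + \<beta> t"
begin

text \<open>Writing the positive part as \<open>max\<close> makes the continuity of the integrand in
  \<open>Y\<close> evident, which the product with an indicator hides.\<close>

definition drift :: "real \<Rightarrow> real \<Rightarrow> real" where
  "drift \<epsilon> s = (s + \<epsilon>) powr (2 * H - 1) / (max (Y \<epsilon> s) 0 + \<epsilon>)"

lemma Y_0: "0 < \<epsilon> \<Longrightarrow> Y \<epsilon> 0 = x0"
  using Y_eq[of \<epsilon> 0] \<beta>_0 by simp

lemma drift_nonneg: "0 < \<epsilon> \<Longrightarrow> 0 \<le> drift \<epsilon> s"
  by (simp add: drift_def)

lemma Y_cont_on: "0 < \<epsilon> \<Longrightarrow> 0 \<le> s \<Longrightarrow> continuous_on {s..t} (Y \<epsilon>)"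
  by (rule continuous_on_subset[OF Y_cont]) auto

lemma drift_cont: "0 < \<epsilon> \<Longrightarrow> 0 \<le> s \<Longrightarrow> continuous_on {s..t} (drift \<epsilon>)"
  unfolding drift_def
  by (intro continuous_intros Y_cont_on) (auto simp: max_def split: if_splits)

lemma Y_integrable: "0 < \<epsilon> \<Longrightarrow> 0 \<le> s \<Longrightarrow> Y \<epsilon> integrable_on {s..t}"
  by (intro integrable_continuous_interval Y_cont_on)

lemma drift_integrable: "0 < \<epsilon> \<Longrightarrow> 0 \<le> s \<Longrightarrow> drift \<epsilon> integrable_on {s..t}"
  by (intro integrable_continuous_interval drift_cont)

lemma Y_drift:
  assumes "0 < \<epsilon>" "0 \<le> t"
  shows "Y \<epsilon> t = x0 + a * integral {0..t} (drift \<epsilon>) - b * integral {0..t} (Y \<epsilon>) + \<beta> t"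
proof -
  have "(\<lambda>s. (s + \<epsilon>) powr (2 * H - 1) / (Y \<epsilon> s * indicator {0<..} (Y \<epsilon> s) + \<epsilon>)) = drift \<epsilon>"
    by (auto simp: drift_def indicator_def fun_eq_iff)
  then show ?thesis
    using Y_eq[OF assms] by simp
qed

lemma Y_increment:
  assumes "0 < \<epsilon>" "0 \<le> s" "s \<le> t"
  shows "Y \<epsilon> t - Y \<epsilon> s =
    a * integral {s..t} (drift \<epsilon>) - b * integral {s..t} (Y \<epsilon>) + (\<beta> t - \<beta> s)"
proof -
  have "integral {0..s} (drift \<epsilon>) + integral {s..t} (drift \<epsilon>) = integral {0..t} (drift \<epsilon>)"
    "integral {0..s} (Y \<epsilon>) + integral {s..t} (Y \<epsilon>) = integral {0..t} (Y \<epsilon>)"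
    using assms drift_integrable Y_integrable by (auto intro: Henstock_Kurzweil_Integration.integral_combine)
  then have "integral {0..t} (drift \<epsilon>) = integral {0..s} (drift \<epsilon>) + integral {s..t} (drift \<epsilon>)"
    "integral {0..t} (Y \<epsilon>) = integral {0..s} (Y \<epsilon>) + integral {s..t} (Y \<epsilon>)"
    by simp_all
  then show ?thesis
    using Y_drift[of \<epsilon> t] Y_drift[of \<epsilon> s] assms by (simp add: algebra_simps)
qed

section \<open>Monotonicity in the regularisation parameter\<close>

lemma drift_antimono:
  assumes "0 < \<epsilon>" "\<epsilon> \<le> \<epsilon>'" "0 \<le> s" "Y \<epsilon> s \<le> Y \<epsilon>' s"
  shows "drift \<epsilon>' s \<le> drift \<epsilon> s"
  \<comment> \<open>Since \<open>2 * H - 1 < 0\<close>, the smaller parameter gives the larger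
    numerator; it also gives the smaller denominator.\<close>
  unfolding drift_def using assms H
  by (intro frac_le powr_mono2') auto

text \<open>After the last time the two paths agree, the path for \<open>\<epsilon>\<close> would
  lie below the other one. It would then have the larger drift and the smaller damping, while the
  noise increments cancel, so it could not have fallen behind.\<close>

lemma comparison:
  assumes "0 < \<epsilon>" "\<epsilon> \<le> \<epsilon>'" "0 \<le> t"
  shows "Y \<epsilon>' t \<le> Y \<epsilon> t"
proof (rule ccontr)
  define D where "D r = Y \<epsilon> r - Y \<epsilon>' r" for r
  have pos: "0 < \<epsilon>'"
    using assms by simp
  assume "\<not> Y \<epsilon>' t \<le> Y \<epsilon> t"
  then have "D t < 0"
    by (simp add: D_def)
  moreover have "continuous_on {0..t} D"
    unfolding D_def using assms pos by (intro continuous_intros Y_cont_on) auto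
  moreover have "0 \<le> D 0"
    using assms pos by (simp add: D_def Y_0)
  ultimately obtain s where s: "0 \<le> s" "s < t" "D s = 0" "\<And>r. s < r \<Longrightarrow> r \<le> t \<Longrightarrow> D r < 0"
    using last_crossing \<open>0 \<le> t\<close> by metis
  have le: "Y \<epsilon> r \<le> Y \<epsilon>' r" if "r \<in> {s..t}" for r
    using s(3) s(4)[of r] that by (cases "r = s") (auto simp: D_def)
  have "integral {s..t} (drift \<epsilon>') \<le> integral {s..t} (drift \<epsilon>)"
    using assms pos s(1) le by (intro integral_le drift_integrable drift_antimono) auto
  moreover have "integral {s..t} (Y \<epsilon>) \<le> integral {s..t} (Y \<epsilon>')"
    using assms pos s(1) le by (intro integral_le Y_integrable) auto
  ultimately have "Y \<epsilon>' t - Y \<epsilon>' s \<le> Y \<epsilon> t - Y \<epsilon> s"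
    using Y_increment[of \<epsilon> s t] Y_increment[of \<epsilon>' s t] assms pos s a b
    by (smt (verit) mult_left_mono)
  then show False
    using \<open>D t < 0\<close> s(3) by (simp add: D_def)
qed

section \<open>Bounds uniform in \<open>\<epsilon>\<close>, and the time spent at or below
  zero\<close>

lemma integral_shifted_powr:
  assumes "0 < \<epsilon>" "0 \<le> s" "s \<le> t"
  shows "((\<lambda>r. (r + \<epsilon>) powr (2 * H - 1)) has_integral
    ((t + \<epsilon>) powr (2 * H) / (2 * H) - (s + \<epsilon>) powr (2 * H) / (2 * H))) {s..t}"
proof (rule fundamental_theorem_of_calculus[OF \<open>s \<le> t\<close>])
  fix r assume "r \<in> {s..t}"
  then show "((\<lambda>r. (r + \<epsilon>) powr (2 * H) / (2 * H)) has_vector_derivative (r + \<epsilon>) powr (2 * H - 1))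
      (at r within {s..t})"
    unfolding has_real_derivative_iff_has_vector_derivative[symmetric]
    using assms H by (auto intro!: derivative_eq_intros)
qed

text \<open>The drift is largest where the path is low; after the last visit to \<open>x0\<close> the path stays
  above \<open>x0\<close>, so there the drift is at most \<open>(r + \<epsilon>) powr (2 * H - 1) / x0\<close>, whose integral is
  bounded uniformly in \<open>\<epsilon>\<close>.\<close>

lemma upper_bound:
  obtains K where "\<And>\<epsilon> t. 0 < \<epsilon> \<Longrightarrow> \<epsilon> \<le> 1 \<Longrightarrow> 0 \<le> t \<Longrightarrow> t \<le> T \<Longrightarrow> Y \<epsilon> t \<le> K"
proof -
  have "bounded (\<beta> ` {0..T})"
    by (intro compact_imp_bounded compact_continuous_image continuous_on_subset[OF \<beta>_cont]) auto
  then obtain C where C: "\<And>t. 0 \<le> t \<Longrightarrow> t \<le> T \<Longrightarrow> \<bar>\<beta> t\<bar> \<le> C"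
    unfolding bounded_iff by (metis atLeastAtMost_iff image_eqI real_norm_def)
  \<comment> \<open>The primitive of \<open>(r + \<epsilon>) powr (2 * H - 1)\<close> at its largest
    possible argument, as \<open>t + \<epsilon> \<le> T + 1\<close>. Because
    \<open>2 * H > 0\<close>, it bounds the integral even as the singularity at 0 is
    approached.\<close>
  define Q where "Q = (T + 1) powr (2 * H) / (2 * H)"
  have "Y \<epsilon> t \<le> x0 + a * (Q / x0) + 2 * C" if \<epsilon>: "0 < \<epsilon>" "\<epsilon> \<le> 1" and t: "0 \<le> t" "t \<le> T" for \<epsilon> t
  proof (cases "Y \<epsilon> t \<le> x0")
    case True
    moreover have "0 \<le> a * (Q / x0)" "0 \<le> C"
      using a x0 H C[of t] t by (auto simp: Q_def)
    ultimately show ?thesis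
      by linarith
  next
    case False
    \<comment> \<open>\<open>last_crossing\<close> describes falling below a level; the sign change
      turns it into the last rise above \<open>x0\<close>.\<close>
    obtain s where s: "0 \<le> s" "s < t" "- Y \<epsilon> s = - x0" "\<And>r. s < r \<Longrightarrow> r \<le> t \<Longrightarrow> - Y \<epsilon> r < - x0"
    proof (rule last_crossing[of 0 t "\<lambda>r. - Y \<epsilon> r" "- x0"])
      show "continuous_on {0..t} (\<lambda>r. - Y \<epsilon> r)"
        using \<epsilon> by (intro continuous_intros Y_cont_on) auto
    qed (use False \<epsilon> t Y_0 in auto)
    have above: "x0 \<le> Y \<epsilon> r" if "r \<in> {s..t}" for r
      using s(3) s(4)[of r] that by (cases "r = s") auto
    note int = integral_shifted_powr[OF \<epsilon>(1) s(1) less_imp_le[OF s(2)]]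
    have "integral {s..t} (drift \<epsilon>) \<le> integral {s..t} (\<lambda>r. (r + \<epsilon>) powr (2 * H - 1) / x0)"
    proof (rule integral_le)
      show "(\<lambda>r. (r + \<epsilon>) powr (2 * H - 1) / x0) integrable_on {s..t}"
        using has_integral_divide[OF int, of x0] by blast
      show "drift \<epsilon> r \<le> (r + \<epsilon>) powr (2 * H - 1) / x0" if "r \<in> {s..t}" for r
        using above[OF that] \<epsilon> x0 unfolding drift_def by (intro divide_left_mono) auto
    qed (use \<epsilon> s drift_integrable in auto)
    also have "\<dots> = ((t + \<epsilon>) powr (2 * H) / (2 * H) - (s + \<epsilon>) powr (2 * H) / (2 * H)) / x0"
      by (rule integral_unique[OF has_integral_divide[OF int]])
    also have "\<dots> \<le> Q / x0"
    proof -
      have "(t + \<epsilon>) powr (2 * H) \<le> (T + 1) powr (2 * H)"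
        using \<epsilon> t H by (intro powr_mono2) auto
      then have "(t + \<epsilon>) powr (2 * H) / (2 * H) - (s + \<epsilon>) powr (2 * H) / (2 * H) \<le> Q"
        using H unfolding Q_def diff_divide_distrib[symmetric]
        by (intro divide_right_mono) (auto intro: order_trans[rotated])
      then show ?thesis
        using x0 by (simp add: divide_right_mono)
    qed
    finally have "a * integral {s..t} (drift \<epsilon>) \<le> a * (Q / x0)"
      using a by (intro mult_left_mono) auto
    moreover have "0 \<le> b * integral {s..t} (Y \<epsilon>)"
      using above x0 b \<epsilon> s by (intro mult_nonneg_nonneg integral_nonneg Y_integrable) force+
    moreover have "\<beta> t - \<beta> s \<le> 2 * C"
      using C[of t] C[of s] s t by auto
    ultimately show ?thesis
      using Y_increment[of \<epsilon> s t] \<epsilon> s by auto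
  qed
  then show ?thesis
    using that by blast
qed

text \<open>By comparison every path with \<open>\<epsilon> \<le> 1\<close> lies above the single
  continuous path \<open>Y 1\<close>, which supplies the lower bound.\<close>

lemma uniform_bound:
  obtains K where "\<And>\<epsilon> t. 0 < \<epsilon> \<Longrightarrow> \<epsilon> \<le> 1 \<Longrightarrow> 0 \<le> t \<Longrightarrow> t \<le> T \<Longrightarrow> \<bar>Y \<epsilon> t\<bar> \<le> K"
proof -
  obtain K where K: "\<And>\<epsilon> t. 0 < \<epsilon> \<Longrightarrow> \<epsilon> \<le> 1 \<Longrightarrow> 0 \<le> t \<Longrightarrow> t \<le> T \<Longrightarrow> Y \<epsilon> t \<le> K"
    using upper_bound by blast
  have "bounded (Y 1 ` {0..T})"
    by (intro compact_imp_bounded compact_continuous_image Y_cont_on) auto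
  then obtain C where C: "\<And>t. 0 \<le> t \<Longrightarrow> t \<le> T \<Longrightarrow> \<bar>Y 1 t\<bar> \<le> C"
    unfolding bounded_iff by (metis atLeastAtMost_iff image_eqI real_norm_def)
  show ?thesis
  proof (rule that)
    fix \<epsilon> t :: real assume *: "0 < \<epsilon>" "\<epsilon> \<le> 1" "0 \<le> t" "t \<le> T"
    show "\<bar>Y \<epsilon> t\<bar> \<le> max K C"
      using K[OF *] C[OF *(3,4)] comparison[OF *(1-3)] by auto
  qed
qed

text \<open>Where \<open>Y \<epsilon> \<le> 0\<close> the denominator of the drift is exactly
  \<open>\<epsilon>\<close>, so the drift is at least \<open>q / \<epsilon>\<close>. Its total
  integral is bounded independently of \<open>\<epsilon>\<close>, and a Markov-type estimate
  follows.\<close>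

lemma measure_nonpositive:
  assumes T: "0 \<le> T"
  obtains C where "\<And>\<epsilon>. 0 < \<epsilon> \<Longrightarrow> \<epsilon> \<le> 1 \<Longrightarrow> {s \<in> {0..T}. Y \<epsilon> s \<le> 0} \<in> lmeasurable \<and>
    measure lebesgue {s \<in> {0..T}. Y \<epsilon> s \<le> 0} \<le> C * \<epsilon>"
proof -
  obtain K where K: "\<And>\<epsilon> t. 0 < \<epsilon> \<Longrightarrow> \<epsilon> \<le> 1 \<Longrightarrow> 0 \<le> t \<Longrightarrow> t \<le> T \<Longrightarrow> \<bar>Y \<epsilon> t\<bar> \<le> K"
    using uniform_bound by blast
  \<comment> \<open>\<open>q\<close> is the least value of the numerator for
    \<open>s \<le> T\<close> and \<open>\<epsilon> \<le> 1\<close>, the exponent being negative.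
    \<open>R\<close> comes from solving the equation at time \<open>T\<close> for the integrated
    drift.\<close>
  define q where "q = (T + 1) powr (2 * H - 1)"
  define R where "R = (K + b * (K * T) + \<bar>\<beta> T\<bar>) / a"
  have "q > 0"
    using T by (simp add: q_def)
  have "{s \<in> {0..T}. Y \<epsilon> s \<le> 0} \<in> lmeasurable \<and>
    measure lebesgue {s \<in> {0..T}. Y \<epsilon> s \<le> 0} \<le> (R / q) * \<epsilon>" if \<epsilon>: "0 < \<epsilon>" "\<epsilon> \<le> 1" for \<epsilon>
  proof -
    let ?A = "{s \<in> {0..T}. Y \<epsilon> s \<le> 0}"
    have "closed ?A"
      using continuous_closed_preimage[OF Y_cont_on[OF \<epsilon>(1) order_refl, of T], of "{..0}"]
      by (simp add: vimage_def Int_def)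
    moreover have "bounded ?A"
      by (rule bounded_subset[OF bounded_closed_interval[of 0 T]]) auto
    ultimately have "compact ?A"
      by (simp add: compact_eq_bounded_closed)
    then have meas: "?A \<in> lmeasurable"
      by (rule lmeasurable_compact)
    then have "((\<lambda>s. 1) has_integral measure lebesgue ?A) ?A"
      using lmeasure_integral[OF meas] integrable_on_const[OF meas] by (metis integrable_integral)
    then have "((\<lambda>s. if s \<in> ?A then 1 else 0) has_integral measure lebesgue ?A) {0..T}"
      by (subst has_integral_restrict) auto
    then have int: "((\<lambda>s. (q / \<epsilon>) * (if s \<in> ?A then 1 else 0)) has_integral (q / \<epsilon>) * measure lebesgue ?A) {0..T}"
      by (rule has_integral_mult_right)
    have "(q / \<epsilon>) * measure lebesgue ?A \<le> integral {0..T} (drift \<epsilon>)"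
    proof (rule has_integral_le[OF int integrable_integral[OF drift_integrable]])
      fix s assume s: "s \<in> {0..T}"
      show "(q / \<epsilon>) * (if s \<in> ?A then 1 else 0) \<le> drift \<epsilon> s"
      proof (cases "s \<in> ?A")
        case True
        then show ?thesis
          using \<epsilon> s H by (auto simp: drift_def q_def intro!: divide_right_mono powr_mono2')
      qed (use \<epsilon> drift_nonneg in auto)
    qed (use \<epsilon> in auto)
    also have "\<dots> \<le> R"
    proof -
      have "\<bar>integral {0..T} (Y \<epsilon>)\<bar> \<le> K * T"
        using integral_bound[OF T Y_cont_on[OF \<epsilon>(1)], of K] K \<epsilon> by auto
      then have "b * integral {0..T} (Y \<epsilon>) \<le> b * (K * T)"
        using b by (intro mult_left_mono) auto
      then have "a * integral {0..T} (drift \<epsilon>) \<le> K + b * (K * T) + \<bar>\<beta> T\<bar>"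
        using Y_drift[OF \<epsilon>(1) T] K[OF \<epsilon> T order_refl] x0 by auto
      then show ?thesis
        using a by (simp add: R_def field_simps)
    qed
    finally show ?thesis
      using meas \<epsilon> \<open>q > 0\<close> by (simp add: field_simps)
  qed
  then show ?thesis
    using that by blast
qed

end

section \<open>The limit path: a null set of nonpositive times, and continuity elsewhere\<close>

locale regularised_paths_limit = regularised_paths +
  fixes X :: "real \<Rightarrow> real"
  assumes lim: "\<And>t. 0 \<le> t \<Longrightarrow> ((\<lambda>\<epsilon>. Y \<epsilon> t) \<longlongrightarrow> X t) (at_right 0)"
begin

lemma eventually_less: "0 < \<epsilon> \<Longrightarrow> eventually (\<lambda>\<epsilon>'. 0 < \<epsilon>' \<and> \<epsilon>' < \<epsilon>) (at_right (0::real))"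
  using eventually_at_right_real[of 0 \<epsilon>] by simp

lemma Y_le_X:
  assumes "0 < \<epsilon>" "0 \<le> t"
  shows "Y \<epsilon> t \<le> X t"
proof (rule tendsto_lowerbound[OF lim[OF assms(2)]])
  show "eventually (\<lambda>\<epsilon>'. Y \<epsilon> t \<le> Y \<epsilon>' t) (at_right 0)"
    using eventually_less[OF assms(1)] by eventually_elim (use assms comparison in auto)
qed simp

lemma X_bounded:
  obtains K where "\<And>t. t \<in> {0..T} \<Longrightarrow> \<bar>X t\<bar> \<le> K"
proof -
  obtain K where K: "\<And>\<epsilon> t. 0 < \<epsilon> \<Longrightarrow> \<epsilon> \<le> 1 \<Longrightarrow> 0 \<le> t \<Longrightarrow> t \<le> T \<Longrightarrow> \<bar>Y \<epsilon> t\<bar> \<le> K"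
    using uniform_bound by blast
  have "\<bar>X t\<bar> \<le> K" if t: "t \<in> {0..T}" for t
  proof (rule tendsto_upperbound)
    show "((\<lambda>\<epsilon>. \<bar>Y \<epsilon> t\<bar>) \<longlongrightarrow> \<bar>X t\<bar>) (at_right 0)"
      using t by (intro tendsto_intros lim) auto
    show "eventually (\<lambda>\<epsilon>. \<bar>Y \<epsilon> t\<bar> \<le> K) (at_right 0)"
      using eventually_less[of 1, OF zero_less_one] by eventually_elim (use t K in auto)
  qed simp
  then show ?thesis
    using that by blast
qed

lemma negligible_X_nonpositive: "negligible {t \<in> {0..}. X t \<le> 0}"
proof -
  have "negligible {t \<in> {0..T}. X t \<le> 0}" if T: "0 \<le> T" for T
    unfolding negligible_outer_le
  proof (intro allI impI)
    fix e :: real assume "0 < e"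
    obtain C where C: "\<And>\<epsilon>. 0 < \<epsilon> \<Longrightarrow> \<epsilon> \<le> 1 \<Longrightarrow> {s \<in> {0..T}. Y \<epsilon> s \<le> 0} \<in> lmeasurable \<and>
        measure lebesgue {s \<in> {0..T}. Y \<epsilon> s \<le> 0} \<le> C * \<epsilon>"
      using measure_nonpositive[OF T] by blast
    \<comment> \<open>No sign of \<open>C\<close> is known; \<open>\<bar>C\<bar> + 1\<close> is a
      positive bound for it by which one can divide.\<close>
    define \<epsilon> where "\<epsilon> = min 1 (e / (\<bar>C\<bar> + 1))"
    have \<epsilon>: "0 < \<epsilon>" "\<epsilon> \<le> 1"
      using \<open>0 < e\<close> by (auto simp: \<epsilon>_def)
    have "C * \<epsilon> \<le> (\<bar>C\<bar> + 1) * (e / (\<bar>C\<bar> + 1))"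
      using \<epsilon> by (intro mult_mono) (auto simp: \<epsilon>_def)
    then have "C * \<epsilon> \<le> e"
      by simp
    moreover have "{t \<in> {0..T}. X t \<le> 0} \<subseteq> {s \<in> {0..T}. Y \<epsilon> s \<le> 0}"
      using Y_le_X[OF \<epsilon>(1)] by force
    ultimately show "\<exists>S. {t \<in> {0..T}. X t \<le> 0} \<subseteq> S \<and> S \<in> lmeasurable \<and> measure lebesgue S \<le> e"
      using C[OF \<epsilon>] order_trans by blast
  qed
  then have "negligible (\<Union>n::nat. {t \<in> {0..real n}. X t \<le> 0})"
    by (intro negligible_Union_nat) auto
  moreover have "{t \<in> {0..}. X t \<le> 0} \<subseteq> (\<Union>n::nat. {t \<in> {0..real n}. X t \<le> 0})"
    using real_arch_simple by fastforce
  ultimately show ?thesis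
    by (rule negligible_subset)
qed

text \<open>Near a point where \<open>X\<close> is positive one approximation, hence by monotonicity every later
  one, is bounded away from zero, which makes the approximations equicontinuous there.\<close>

lemma continuous_at_positive:
  assumes t: "0 < t" and "0 < X t"
  shows "continuous (at t within {0..}) X"
proof -
  obtain \<epsilon>0 where \<epsilon>0: "0 < \<epsilon>0" "\<epsilon>0 < 1" "0 < Y \<epsilon>0 t"
  proof -
    have "eventually (\<lambda>\<epsilon>. 0 < Y \<epsilon> t) (at_right 0)"
      using order_tendstoD(1)[OF lim \<open>0 < X t\<close>] t by simp
    then have "eventually (\<lambda>\<epsilon>. 0 < \<epsilon> \<and> \<epsilon> < 1 \<and> 0 < Y \<epsilon> t) (at_right 0)"
      using eventually_less[of 1, OF zero_less_one] by eventually_elim auto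
    then show ?thesis
      using that eventually_happens[of _ "at_right (0::real)"] by (auto simp: trivial_limit_at_right_real)
  qed
  define c where "c = Y \<epsilon>0 t / 2"
  have "c > 0"
    using \<epsilon>0 by (simp add: c_def)
  have "(Y \<epsilon>0 \<longlongrightarrow> Y \<epsilon>0 t) (at t within {0..})"
    using Y_cont[OF \<epsilon>0(1)] t by (auto simp: continuous_on_def)
  then have "eventually (\<lambda>s. c < Y \<epsilon>0 s) (at t within {0..})"
    using \<epsilon>0(3) by (intro order_tendstoD(1)) (auto simp: c_def)
  then obtain \<delta>0 where "\<delta>0 > 0" and \<delta>0: "\<And>s. 0 \<le> s \<Longrightarrow> s \<noteq> t \<Longrightarrow> \<bar>s - t\<bar> < \<delta>0 \<Longrightarrow> c < Y \<epsilon>0 s"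
    unfolding eventually_at dist_real_def by auto
  \<comment> \<open>Radius at most \<open>t / 2\<close> keeps times above \<open>t / 2\<close>, away
    from the singularity of the numerator at 0, and below \<open>2 * t\<close>, where
    \<open>K\<close> applies.\<close>
  define \<delta> where "\<delta> = min \<delta>0 (t / 2)"
  have \<delta>: "0 < \<delta>" "\<delta> \<le> t / 2"
    using \<open>\<delta>0 > 0\<close> t by (auto simp: \<delta>_def)
  obtain K where K: "\<And>\<epsilon> s. 0 < \<epsilon> \<Longrightarrow> \<epsilon> \<le> 1 \<Longrightarrow> 0 \<le> s \<Longrightarrow> s \<le> 2 * t \<Longrightarrow> \<bar>Y \<epsilon> s\<bar> \<le> K"
    using uniform_bound by blast
  \<comment> \<open>\<open>D\<close> bounds the drift near \<open>t\<close> for all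
    \<open>\<epsilon> \<le> \<epsilon>0\<close>, and \<open>L\<close> is the resulting Lipschitz
    constant of drift and damping together. Neither depends on \<open>\<epsilon>\<close>.\<close>
  define D where "D = (t / 2) powr (2 * H - 1) / c"
  define L where "L = a * D + b * K"
  have drift_le: "drift \<epsilon> r \<le> D" if \<epsilon>: "0 < \<epsilon>" "\<epsilon> \<le> \<epsilon>0" and r: "\<bar>r - t\<bar> < \<delta>" for \<epsilon> r
  proof -
    have "t / 2 \<le> r"
      using r \<delta> by (auto simp: abs_if split: if_splits)
    have "c \<le> Y \<epsilon>0 r"
      using \<delta>0[of r] r \<open>t / 2 \<le> r\<close> t \<epsilon>0(3) by (cases "r = t") (auto simp: \<delta>_def c_def)
    also have "\<dots> \<le> Y \<epsilon> r"
      using comparison[OF \<epsilon>] \<open>t / 2 \<le> r\<close> t by auto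
    finally show ?thesis
      unfolding drift_def D_def using \<open>t / 2 \<le> r\<close> t \<epsilon> H \<open>c > 0\<close>
      by (intro frac_le powr_mono2') auto
  qed
  \<comment> \<open>The noise increment is common to all \<open>\<epsilon>\<close>, so it is kept as
    it stands and the estimate survives the limit.\<close>
  have Y_lipschitz: "\<bar>Y \<epsilon> v - Y \<epsilon> u\<bar> \<le> L * (v - u) + \<bar>\<beta> v - \<beta> u\<bar>"
    if \<epsilon>: "0 < \<epsilon>" "\<epsilon> \<le> \<epsilon>0" and uv: "u \<le> v" "\<bar>u - t\<bar> < \<delta>" "\<bar>v - t\<bar> < \<delta>" for \<epsilon> u v
  proof -
    have "0 \<le> u" "v \<le> 2 * t"
      using uv \<delta> by auto
    have near: "\<bar>r - t\<bar> < \<delta>" if "r \<in> {u..v}" for r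
      using that uv by auto
    have "\<bar>integral {u..v} (drift \<epsilon>)\<bar> \<le> D * (v - u)"
      using integral_bound[OF uv(1) drift_cont[OF \<epsilon>(1) \<open>0 \<le> u\<close>], of D] drift_le[OF \<epsilon> near]
        drift_nonneg[OF \<epsilon>(1)] by auto
    moreover have "\<bar>integral {u..v} (Y \<epsilon>)\<bar> \<le> K * (v - u)"
      using integral_bound[OF uv(1) Y_cont_on[OF \<epsilon>(1) \<open>0 \<le> u\<close>], of K] K \<epsilon> \<epsilon>0 \<open>0 \<le> u\<close> \<open>v \<le> 2 * t\<close>
      by auto
    ultimately have "\<bar>a * integral {u..v} (drift \<epsilon>)\<bar> \<le> a * (D * (v - u))"
      "\<bar>b * integral {u..v} (Y \<epsilon>)\<bar> \<le> b * (K * (v - u))"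
      using a b by (auto simp: abs_mult intro: mult_left_mono)
    moreover have "L * (v - u) = a * (D * (v - u)) + b * (K * (v - u))"
      by (simp add: L_def algebra_simps)
    ultimately show ?thesis
      using Y_increment[OF \<epsilon>(1) \<open>0 \<le> u\<close> uv(1)] by linarith
  qed
  have X_lipschitz: "\<bar>X s - X t\<bar> \<le> L * \<bar>s - t\<bar> + \<bar>\<beta> s - \<beta> t\<bar>" if s: "\<bar>s - t\<bar> < \<delta>" for s
  proof (rule tendsto_upperbound)
    show "((\<lambda>\<epsilon>. \<bar>Y \<epsilon> s - Y \<epsilon> t\<bar>) \<longlongrightarrow> \<bar>X s - X t\<bar>) (at_right 0)"
      using s t \<delta> by (intro tendsto_intros lim) auto
    show "eventually (\<lambda>\<epsilon>. \<bar>Y \<epsilon> s - Y \<epsilon> t\<bar> \<le> L * \<bar>s - t\<bar> + \<bar>\<beta> s - \<beta> t\<bar>) (at_right 0)"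
      using eventually_less[OF \<epsilon>0(1)]
    proof eventually_elim
      case (elim \<epsilon>)
      then show ?case
        using Y_lipschitz[of \<epsilon> s t] Y_lipschitz[of \<epsilon> t s] s \<delta>
        by (cases "s \<le> t") (auto simp: abs_minus_commute)
    qed
  qed simp
  have "(\<beta> \<longlongrightarrow> \<beta> t) (at t within {0..})"
    using \<beta>_cont t by (auto simp: continuous_on_def)
  then have "((\<lambda>s. L * \<bar>s - t\<bar> + \<bar>\<beta> s - \<beta> t\<bar>) \<longlongrightarrow> L * \<bar>t - t\<bar> + \<bar>\<beta> t - \<beta> t\<bar>) (at t within {0..})"
    by (intro tendsto_intros)
  then have bound_lim: "((\<lambda>s. L * \<bar>s - t\<bar> + \<bar>\<beta> s - \<beta> t\<bar>) \<longlongrightarrow> 0) (at t within {0..})"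
    by simp
  have "((\<lambda>s. X s - X t) \<longlongrightarrow> 0) (at t within {0..})"
  proof (rule Lim_null_comparison[OF _ bound_lim])
    show "eventually (\<lambda>s. norm (X s - X t) \<le> L * \<bar>s - t\<bar> + \<bar>\<beta> s - \<beta> t\<bar>) (at t within {0..})"
      unfolding eventually_at dist_real_def using \<delta>(1) X_lipschitz by auto
  qed
  then show ?thesis
    by (simp add: continuous_within LIM_zero_iff)
qed

text \<open>The point 0 is added separately because \<open>continuous_at_positive\<close> needs a
  window bounded away from time 0.\<close>

lemma negligible_discontinuities: "negligible {t \<in> {0..}. \<not> continuous (at t within {0..}) X}"
proof (rule negligible_subset)
  show "negligible (insert 0 {t \<in> {0..}. X t \<le> 0})"
    using negligible_X_nonpositive by simp
  show "{t \<in> {0..}. \<not> continuous (at t within {0..}) X} \<subseteq> insert 0 {t \<in> {0..}. X t \<le> 0}"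
  proof
    fix t assume "t \<in> {t \<in> {0..}. \<not> continuous (at t within {0..}) X}"
    then show "t \<in> insert 0 {t \<in> {0..}. X t \<le> 0}"
      using continuous_at_positive[of t] by (cases "t = 0 \<or> X t \<le> 0") simp_all
  qed
qed

lemma riemann_integrable_X:
  assumes "0 \<le> u"
  shows "riemann_integrable X u v"
proof -
  obtain K where "\<And>t. t \<in> {0..v} \<Longrightarrow> \<bar>X t\<bar> \<le> K"
    using X_bounded by blast
  then show ?thesis
    using assms
    by (intro bounded_ae_continuous_imp_riemann_integrable[OF negligible_discontinuities, of _ _ _ K])
      (auto intro: continuous_within_subset[of _ "{0..}"])
qed

end

theorem corollary3p8:
  fixes M :: "'w measure"
    and H x0 a b \<sigma> :: real
    and B :: "real \<Rightarrow> 'w \<Rightarrow> real"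
    and Xeps :: "real \<Rightarrow> real \<Rightarrow> 'w \<Rightarrow> real"
    and X :: "real \<Rightarrow> 'w \<Rightarrow> real"
  assumes "prob_space M" and "complete_measure M"
    and "0 < H" and "H < 1/2"
    and "x0 > 0" and "a > 0" and "b \<ge> 0" and "\<sigma> > 0"
    and "fractional_brownian_motion M H B"
    and "regular_paths M H B"
    and "\<And>\<epsilon>. \<epsilon> > 0 \<Longrightarrow> regularised_solution M H x0 a b \<sigma> B \<epsilon> (Xeps \<epsilon>)"
    and "\<And>t \<omega>. t \<ge> 0 \<Longrightarrow> \<omega> \<in> space M \<Longrightarrow> ((\<lambda>\<epsilon>. Xeps \<epsilon> t \<omega>) \<longlongrightarrow> X t \<omega>) (at_right 0)"
  shows "\<forall>\<omega>\<in>space M.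
      (AE t in lebesgue. t \<in> {0..} \<longrightarrow> continuous (at t within {0..}) (\<lambda>s. X s \<omega>)) \<and>
      (\<forall>u v. 0 \<le> u \<and> u \<le> v \<longrightarrow> riemann_integrable (\<lambda>t. X t \<omega>) u v)"
proof (intro ballI conjI allI impI)
  fix \<omega> assume \<omega>: "\<omega> \<in> space M"
  \<comment> \<open>For fixed \<open>\<omega>\<close> the scaled noise
    \<open>\<sigma> * B t \<omega>\<close> is a deterministic continuous path starting at 0, and
    takes the place of \<open>\<beta>\<close>.\<close>
  interpret regularised_paths_limit H x0 a b "\<lambda>t. \<sigma> * B t \<omega>" "\<lambda>\<epsilon> t. Xeps \<epsilon> t \<omega>" "\<lambda>t. X t \<omega>"
  proof
    show "continuous_on {0..} (\<lambda>t. \<sigma> * B t \<omega>)" "\<sigma> * B 0 \<omega> = 0"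
      using assms(10) \<omega> by (auto simp: regular_paths_def intro!: continuous_intros)
    fix \<epsilon> t :: real assume \<epsilon>: "0 < \<epsilon>"
    note sol = assms(11)[OF \<epsilon>, unfolded regularised_solution_def, THEN conjunct2,
        THEN bspec, OF \<omega>]
    show "continuous_on {0..} (\<lambda>t. Xeps \<epsilon> t \<omega>)"
      using sol by (rule conjunct1)
    assume "0 \<le> t"
    then show "Xeps \<epsilon> t \<omega> = x0
        + a * integral {0..t}
            (\<lambda>s. (s + \<epsilon>) powr (2 * H - 1) / (Xeps \<epsilon> s \<omega> * indicator {0<..} (Xeps \<epsilon> s \<omega>) + \<epsilon>))
        - b * integral {0..t} (\<lambda>s. Xeps \<epsilon> s \<omega>) + \<sigma> * B t \<omega>"
      using sol[THEN conjunct2, rule_format] by blast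
  qed (use assms(3-7) assms(12)[OF _ \<omega>] in auto)
  have "{t \<in> {0..}. \<not> continuous (at t within {0..}) (\<lambda>s. X s \<omega>)} \<in> null_sets lebesgue"
    using negligible_discontinuities by (simp add: negligible_iff_null_sets)
  then show "AE t in lebesgue. t \<in> {0..} \<longrightarrow> continuous (at t within {0..}) (\<lambda>s. X s \<omega>)"
    by (rule AE_I') auto
  fix u v :: real assume "0 \<le> u \<and> u \<le> v"
  then show "riemann_integrable (\<lambda>t. X t \<omega>) u v"
    using riemann_integrable_X by blast
qed

end
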